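(* Let $(a_1,a_2)\in\Lambda$ and let $\mathcal{A}\subset\mathbb{R}^3$ be the set of all permutations of $(a_2,\,a_1+1/2,\,2a_1)$. If $(b_1,b_2,b_3)\in\boldsymbol{\Gamma}_+(\mathcal{A})$, then $$\Phi(x)={}_2F_3\left[\begin{array}{c} a_1,a_2\\ b_1,b_2,b_3\end{array}\biggr|\,-x^2\right]\ge 0\quad\text{for all } x>0,$$ and the strict inequality $\Phi(x)>0$ holds for all $x>0$ unless $(b_1,b_2,b_3)\in\mathcal{A}$.
   Context: Notation: ${}_2F_3\left[\begin{array}{c} a_1,a_2\\ b_1,b_2,b_3\end{array}\big|\,z\right]=\sum_{n=0}^\infty\frac{(a_1)_n(a_2)_n}{n!\,(b_1)_n(b_2)_n(b_3)_n}z^n$, where $(\alpha)_n=\alpha(\alpha+1)\cdots(\alpha+n-1)$ and $(\alpha)_0=1$. $\mathbb{R}_+=[0,\infty)$. $\Lambda$ is the set of all pairs $(a_1,a_2)$ with $a_1>0$, $a_2>0$ such that: if $a_1\le 1/2$, then either $a_2\le\frac12\left(3a_1+\frac12\right)$ or $1\le a_2\le 2a_1+1$; if $a_1\ge 1/2$, then $a_2\le\max\left[a_1+\frac32,\ \frac32\left(a_1+\frac12\right)\right]$. For a set $E\subset\mathbb{R}_+^3$, the Newton polyhedron $\boldsymbol{\Gamma}_+(E)$ is the convex hull of $\bigcup_{\mathbf{x}\in E}(\mathbf{x}+\mathbb{R}_+^3)$. *)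

theory Defs
  imports "HOL-Analysis.Analysis"
begin

text \<open>
  As for any \<^const>\<open>suminf\<close>, the value is meaningful where the series converges; it converges for
  all arguments when the lower parameters are positive.
\<close>

definition hypergeo_2F3 :: "real \<Rightarrow> real \<Rightarrow> real \<Rightarrow> real \<Rightarrow> real \<Rightarrow> real \<Rightarrow> real" where
  "hypergeo_2F3 a1 a2 b1 b2 b3 z = eval_fps (fps_hypergeo [a1, a2] [b1, b2, b3] 1) z"

lemma hypergeo_2F3_series:
  "hypergeo_2F3 a1 a2 b1 b2 b3 z =
     (\<Sum>n. (pochhammer a1 n * pochhammer a2 n)
          / (fact n * (pochhammer b1 n * pochhammer b2 n * pochhammer b3 n)) * z ^ n)"
  by (simp add: hypergeo_2F3_def eval_fps_def mult_ac)

definition Lambda_region :: "(real \<times> real) set" where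
  "Lambda_region =
     {(a1, a2). a1 > 0 \<and> a2 > 0
        \<and> (a1 \<le> 1/2 \<longrightarrow> a2 \<le> 1/2 * (3 * a1 + 1/2) \<or> (1 \<le> a2 \<and> a2 \<le> 2 * a1 + 1))
        \<and> (a1 \<ge> 1/2 \<longrightarrow> a2 \<le> max (a1 + 3/2) (3/2 * (a1 + 1/2)))}"

definition nonneg_orthant :: "(real ^ 'n) set" where
  "nonneg_orthant = {y. \<forall>i. 0 \<le> y $ i}"

text \<open>
  Newton polyhedra are meant for subsets of the nonnegative orthant; the sets of permutations
  of nonnegative vectors satisfy this by the lemmas below.
\<close>

definition newton_polyhedron :: "(real ^ 'n) set \<Rightarrow> (real ^ 'n) set" where
  "newton_polyhedron E = convex hull (\<Union>x\<in>E. (\<lambda>y. x + y) ` nonneg_orthant)"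

definition coord_permutations :: "'a ^ 'n \<Rightarrow> ('a ^ 'n) set" where
  "coord_permutations v = {\<chi> i. v $ p i | p. p permutes UNIV}"

lemma coord_permutations_subset_nonneg_orthant:
  "v \<in> nonneg_orthant \<Longrightarrow> coord_permutations v \<subseteq> nonneg_orthant"
  by (auto simp: coord_permutations_def nonneg_orthant_def)

lemma vector_3_in_nonneg_orthant_iff:
  "(vector [x, y, z] :: real ^ 3) \<in> nonneg_orthant \<longleftrightarrow> 0 \<le> x \<and> 0 \<le> y \<and> 0 \<le> z"
  by (simp add: nonneg_orthant_def forall_3)

end

theory Submission
  imports Defs
begin

text \<open>
  Write \<open>v = (a\<^sub>2, a\<^sub>1 + 1/2, 2 a\<^sub>1)\<close>. For \<open>b = v\<close> the function is
  \<open>\<^sub>1F\<^sub>2(a\<^sub>1; a\<^sub>1 + 1/2, 2 a\<^sub>1; -x\<^sup>2)\<close>, the square of a normalised Bessel function. Passing from \<open>v\<close> to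
  other parameters multiplies the \<open>n\<close>-th coefficient by a ratio of Pochhammer symbols, and it is
  enough that this multiplier preserves nonnegativity on \<open>[0, \<infinity>)\<close>. Raising a single parameter
  \<open>q\<close> to \<open>q + e\<close> is averaging against the Beta density. A point \<open>h\<close> in the convex hull of the
  permutations of \<open>v\<close> has the same coordinate sum as \<open>v\<close>, no larger Euclidean norm, and no coordinate
  below the minimum of \<open>v\<close>; these facts make each factor in
  \<open>\<Prod>\<^sub>m \<Prod>\<^sub>i (h\<^sub>i + m + n) / (v\<^sub>i + m + n)\<close>, which is a constant times \<open>\<Prod>\<^sub>i (v\<^sub>i)\<^sub>n / (h\<^sub>i)\<^sub>n\<close>, equal to \<open>1\<close>
  plus nonnegative multiples of products of \<open>1 / (v\<^sub>i + m + n)\<close>, themselves averaging operators. The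
  partial products therefore increase, and Tannery's theorem gives the limit. Averaging a
  nonnegative function that is positive at \<open>0\<close> gives a strictly positive one, whence strictness.
\<close>

subsection \<open>Multipliers given by Beta averages\<close>

text \<open>The class that all multipliers below preserve. The argument \<open>s\<close> plays the
  role of x^2, so the alternating sign is kept inside \<open>A\<close>. The condition
  \<open>A 0 > 0\<close> is what makes Beta averages strictly positive.\<close>

definition pos_series :: "(nat \<Rightarrow> real) \<Rightarrow> bool" where
  "pos_series A \<longleftrightarrow>
     (\<forall>s. summable (\<lambda>n. A n * s ^ n)) \<and> A 0 > 0 \<and> (\<forall>s\<ge>0. 0 \<le> (\<Sum>n. A n * s ^ n))"

section \<open>Entire power series and bounded multipliers\<close>

lemma entire_abs_summable:
  fixes A :: "nat \<Rightarrow> real"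
  assumes "\<And>s. summable (\<lambda>n. A n * s ^ n)"
  shows "summable (\<lambda>n. \<bar>A n * s ^ n\<bar>)"
proof -
  have "summable (\<lambda>n. norm (A n * s ^ n))"
    by (rule powser_insidea[OF assms[of "\<bar>s\<bar> + 1"]]) auto
  then show ?thesis by simp
qed

lemma entire_mult_bounded:
  fixes A B :: "nat \<Rightarrow> real"
  assumes "\<And>s. summable (\<lambda>n. A n * s ^ n)" and "\<And>n. \<bar>B n\<bar> \<le> C"
  shows "summable (\<lambda>n. (A n * B n) * s ^ n)"
proof (rule summable_comparison_test')
  show "summable (\<lambda>n. C * \<bar>A n * s ^ n\<bar>)"
    by (intro summable_mult entire_abs_summable assms)
  show "norm (A n * B n * s ^ n) \<le> C * \<bar>A n * s ^ n\<bar>" for n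
    using mult_right_mono[OF assms(2)[of n] abs_ge_zero[of "A n * s ^ n"]]
    by (simp add: abs_mult mult_ac)
qed

section \<open>Pochhammer ratios as moments of the Beta density\<close>

lemma Gamma_plus_nat:
  fixes z :: real
  assumes "z > 0"
  shows "Gamma (z + real n) = pochhammer z n * Gamma z"
proof -
  have "z \<notin> \<int>\<^sub>\<le>\<^sub>0" using assms by (auto elim!: nonpos_Ints_cases)
  then show ?thesis using pochhammer_Gamma[of z n] Gamma_real_pos[OF assms] by simp
qed

lemma Beta_ratio_pochhammer:
  fixes q e :: real
  assumes "q > 0" "e > 0"
  shows "Beta (q + real n) e = Beta q e * (pochhammer q n / pochhammer (q + e) n)"
proof -
  have "Gamma (q + real n + e) = pochhammer (q + e) n * Gamma (q + e)"
    using Gamma_plus_nat[of "q + e"] assms by (simp add: add_ac)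
  then show ?thesis using Gamma_plus_nat[of q] assms by (simp add: Beta_def mult_ac)
qed

lemma pochhammer_ratio_le_1:
  fixes q e :: real
  assumes "q > 0" "e \<ge> 0"
  shows "\<bar>pochhammer q n / pochhammer (q + e) n\<bar> \<le> 1"
proof -
  have "pochhammer q n \<le> pochhammer (q + e) n"
    unfolding pochhammer_prod using assms by (intro prod_mono) auto
  then show ?thesis
    using pochhammer_pos[of q n] pochhammer_pos[of "q + e" n] assms by simp
qed

text \<open>Termwise integration: the n-th moment of the Beta weight is \<open>Beta q e\<close>
  times the Pochhammer ratio. For t in [0,1] the partial sums are bounded by the constant
  \<open>C\<close>, so dominated convergence applies.\<close>

lemma beta_integral_series:
  fixes A :: "nat \<Rightarrow> real" and q e s :: real
  assumes sA: "\<And>s. summable (\<lambda>n. A n * s ^ n)" and q: "q > 0" and e: "e > 0"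
  shows "((\<lambda>t. (\<Sum>n. A n * (s * t) ^ n) * (t powr (q - 1) * (1 - t) powr (e - 1))) has_integral
           Beta q e * (\<Sum>n. A n * (pochhammer q n / pochhammer (q + e) n) * s ^ n)) {0..1}"
proof -
  define w where "w = (\<lambda>t::real. t powr (q - 1) * (1 - t) powr (e - 1))"
  define m where "m = (\<lambda>n. pochhammer q n / pochhammer (q + e) n)"
  define C where "C = (\<Sum>n. \<bar>A n * s ^ n\<bar>)"
  have w0: "w t \<ge> 0" for t by (simp add: w_def)
  have abs_sum: "summable (\<lambda>n. \<bar>A n * s ^ n\<bar>)" by (rule entire_abs_summable[OF sA])
  have moment: "((\<lambda>t. t ^ n * w t) has_integral Beta q e * m n) {0..1}" for n
  proof -
    have "((\<lambda>t. t powr (q + real n - 1) * (1 - t) powr (e - 1)) has_integral Beta (q + real n) e) {0..1}"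
      using q e by (intro has_integral_Beta_real) auto
    then have "((\<lambda>t. t powr (q + real n - 1) * (1 - t) powr (e - 1)) has_integral Beta q e * m n) {0..1}"
      using q e by (simp add: Beta_ratio_pochhammer m_def)
    then show ?thesis
    \<comment> \<open>The point 0 is discarded because \<open>powr_realpow\<close> needs a positive
      base.\<close>
    proof (rule has_integral_spike_finite[where S = "{0}", rotated 2])
      show "t ^ n * w t = t powr (q + real n - 1) * (1 - t) powr (e - 1)" if "t \<in> {0..1} - {0}" for t
      proof -
        have "t > 0" using that by auto
        moreover have "q + real n - 1 = real n + (q - 1)" by simp
        ultimately show ?thesis
          by (simp only: powr_add) (simp add: w_def powr_realpow)
      qed
    qed simp
  qed
  have "((\<lambda>t. (\<Sum>n. A n * (s * t) ^ n) * w t) has_integral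
          Beta q e * (\<Sum>n. A n * m n * s ^ n)) {0..1}"
  proof (rule has_integral_dominated_convergence)
    show "((\<lambda>t. (\<Sum>n<k. A n * (s * t) ^ n) * w t) has_integral
            (\<Sum>n<k. A n * s ^ n * (Beta q e * m n))) {0..1}" for k
    proof -
      have "((\<lambda>t. \<Sum>n<k. A n * s ^ n * (t ^ n * w t)) has_integral
            (\<Sum>n<k. A n * s ^ n * (Beta q e * m n))) {0..1}"
        by (intro has_integral_sum has_integral_mult_right moment) auto
      then show ?thesis
        by (simp add: sum_distrib_right sum_distrib_left power_mult_distrib mult_ac)
    qed
    show "(\<lambda>t. C * w t) integrable_on {0..1}"
      using has_integral_mult_right[OF moment[of 0], of C] by (auto simp: integrable_on_def)
    show "\<forall>t\<in>{0..1}. norm ((\<Sum>n<k. A n * (s * t) ^ n) * w t) \<le> C * w t" for k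
    proof
      fix t :: real assume t: "t \<in> {0..1}"
      have "\<bar>\<Sum>n<k. A n * (s * t) ^ n\<bar> \<le> (\<Sum>n<k. \<bar>A n * (s * t) ^ n\<bar>)" by (rule sum_abs)
      also have "\<dots> \<le> (\<Sum>n<k. \<bar>A n * s ^ n\<bar>)"
      proof (rule sum_mono)
        fix n
        have "\<bar>A n * s ^ n\<bar> * t ^ n \<le> \<bar>A n * s ^ n\<bar> * 1"
          using t by (intro mult_left_mono power_le_one) auto
        then show "\<bar>A n * (s * t) ^ n\<bar> \<le> \<bar>A n * s ^ n\<bar>"
          using t by (simp add: power_mult_distrib abs_mult mult_ac power_abs)
      qed
      also have "\<dots> \<le> C" unfolding C_def
        by (intro sum_le_suminf abs_sum) auto
      finally show "norm ((\<Sum>n<k. A n * (s * t) ^ n) * w t) \<le> C * w t"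
        using w0 by (simp add: abs_mult mult_right_mono)
    qed
    show "\<forall>t\<in>{0..1}. (\<lambda>k. (\<Sum>n<k. A n * (s * t) ^ n) * w t) \<longlonglongrightarrow> (\<Sum>n. A n * (s * t) ^ n) * w t"
      by (intro ballI tendsto_intros summable_LIMSEQ sA)
    have "(\<lambda>k. \<Sum>n<k. A n * m n * s ^ n) \<longlonglongrightarrow> (\<Sum>n. A n * m n * s ^ n)"
      using q e unfolding m_def
      by (intro summable_LIMSEQ entire_mult_bounded[where C = 1] sA pochhammer_ratio_le_1) auto
    then have "(\<lambda>k. Beta q e * (\<Sum>n<k. A n * m n * s ^ n)) \<longlonglongrightarrow> Beta q e * (\<Sum>n. A n * m n * s ^ n)"
      by (rule tendsto_mult_left)
    then show "(\<lambda>k. \<Sum>n<k. A n * s ^ n * (Beta q e * m n)) \<longlonglongrightarrow> Beta q e * (\<Sum>n. A n * m n * s ^ n)"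
      by (simp add: sum_distrib_left mult_ac)
  qed
  then show ?thesis by (simp add: w_def m_def)
qed

text \<open>A continuous nonnegative function with zero integral over [c,d] vanishes there,
  contradicting \<open>g c > 0\<close>. Continuity is asked for only on a subinterval, since the
  Beta weight may blow up at 0 and 1.\<close>

lemma has_integral_pos_of_continuous:
  fixes g :: "real \<Rightarrow> real"
  assumes "(g has_integral I) {a..b}" and nonneg: "\<And>t. t \<in> {a..b} \<Longrightarrow> g t \<ge> 0"
    and cd: "a \<le> c" "c < d" "d \<le> b"
    and cont: "continuous_on {c..d} g" and pos: "g c > 0"
  shows "I > 0"
proof -
  have int: "(g has_integral integral {c..d} g) {c..d}"
    using cont integrable_continuous_interval by blast
  have "integral {c..d} g \<noteq> 0"
  proof
    assume "integral {c..d} g = 0"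
    then have "(g has_integral 0) (cbox c d)" using int by simp
    then have "g c = 0"
      using cont cd nonneg by (intro has_integral_0_cbox_imp_0[of c d g]) (auto simp: box_real)
    then show False using pos by simp
  qed
  moreover have "integral {c..d} g \<ge> 0"
    using cd by (intro has_integral_nonneg[OF int] nonneg) auto
  moreover have "integral {c..d} g \<le> I"
    by (rule has_integral_subset_le[OF _ int assms(1)]) (use cd nonneg in auto)
  ultimately show ?thesis by simp
qed

text \<open>By continuity and \<open>A 0 > 0\<close> the series is positive near 0, so the averaged
  integrand is positive at small t > 0 and nonnegative elsewhere.\<close>

lemma beta_multiplier_pos:
  assumes A: "pos_series A" and q: "q > 0" and e: "e > 0" and s: "s \<ge> 0"
  shows "(\<Sum>n. A n * (pochhammer q n / pochhammer (q + e) n) * s ^ n) > 0"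
proof -
  let ?f = "\<lambda>x. \<Sum>n. A n * x ^ n"
  have sA: "\<And>s. summable (\<lambda>n. A n * s ^ n)" and A0: "A 0 > 0"
    and f0: "\<And>s. s \<ge> 0 \<Longrightarrow> 0 \<le> ?f s" using A by (auto simp: pos_series_def)
  have cont: "isCont ?f x" for x by (rule isCont_powser_converges_everywhere[OF sA])
  have contf: "continuous_on S ?f" for S using cont by (simp add: continuous_at_imp_continuous_on)
  have "\<forall>\<^sub>F x in at 0. ?f x > 0"
    using cont[of 0] A0 by (auto simp: isCont_def intro: order_tendstoD)
  then obtain d where d: "d > 0" "\<And>x. x \<noteq> 0 \<Longrightarrow> \<bar>x\<bar> < d \<Longrightarrow> ?f x > 0"
    by (auto simp: eventually_at dist_real_def)
  have near: "?f x > 0" if "\<bar>x\<bar> < d" for x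
    using d(2)[of x] A0 that by (cases "x = 0") auto
  \<comment> \<open>The bound 1/2 keeps \<open>u\<close> inside (0,1); the other bound forces
    \<open>s * u < d\<close>, with \<open>s + 1\<close> avoiding a division by zero at
    \<open>s = 0\<close>. The interval from \<open>u\<close> to the midpoint of \<open>u\<close> and
    1 then avoids both endpoint singularities.\<close>
  define u where "u = min (1/2) (d / (2 * (s + 1)))"
  have u: "u > 0" "u < 1" using d(1) s by (auto simp: u_def)
  have "s * u \<le> s * (d / (2 * (s + 1)))" using s by (intro mult_left_mono) (auto simp: u_def)
  also have "\<dots> < d" using s d(1) by (simp add: field_simps add_strict_increasing2)
  finally have su: "s * u < d" .
  have "Beta q e * (\<Sum>n. A n * (pochhammer q n / pochhammer (q + e) n) * s ^ n) > 0"
  proof (rule has_integral_pos_of_continuous[OF beta_integral_series[OF sA q e]])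
    show "0 \<le> ?f (s * t) * (t powr (q - 1) * (1 - t) powr (e - 1))" if "t \<in> {0..1}" for t
      using f0[of "s * t"] s that by auto
    show "0 \<le> u" "u < (1 + u) / 2" "(1 + u) / 2 \<le> 1" using u by auto
    show "continuous_on {u..(1 + u) / 2} (\<lambda>t. ?f (s * t) * (t powr (q - 1) * (1 - t) powr (e - 1)))"
      using u by (intro continuous_intros continuous_on_compose2[OF contf[of UNIV]]) auto
    show "?f (s * u) * (u powr (q - 1) * (1 - u) powr (e - 1)) > 0"
      using near[of "s * u"] su s u by auto
  qed
  moreover have "Beta q e > 0" using q e by (simp add: Beta_def Gamma_real_pos)
  ultimately show ?thesis by (simp add: zero_less_mult_iff)
qed

lemma beta_multiplier:
  assumes A: "pos_series A" and q: "q > 0" and e: "e \<ge> 0"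
  shows "pos_series (\<lambda>n. A n * (pochhammer q n / pochhammer (q + e) n))"
proof (cases "e = 0")
  case True
  have "pochhammer q n \<noteq> 0" for n using q pochhammer_pos[of q n] by simp
  then show ?thesis using True A by simp
next
  case False
  then have "e > 0" using e by simp
  then show ?thesis
    using A q beta_multiplier_pos[OF A q \<open>e > 0\<close>]
      entire_mult_bounded[of A, OF _ pochhammer_ratio_le_1[OF q e]]
    by (auto simp: pos_series_def intro: less_imp_le)
qed

text \<open>The case e = 1 of the Beta average: (p)_n / (p+1)_n = p / (p+n).\<close>

lemma inverse_linear_multiplier:
  assumes A: "pos_series A" and p: "p > 0"
  shows "pos_series (\<lambda>n. A n / (p + real n))"
    and "s \<ge> 0 \<Longrightarrow> (\<Sum>n. A n / (p + real n) * s ^ n) > 0"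
proof -
  have "pochhammer p n / pochhammer (p + 1) n = p / (p + real n)" for n
  proof -
    have "pochhammer p n * (p + real n) = p * pochhammer (p + 1) n"
      using pochhammer_rec[of p n] pochhammer_Suc[of p n] by simp
    moreover have "pochhammer (p + 1) n > 0" using p by (intro pochhammer_pos) auto
    ultimately show ?thesis using p by (simp add: field_simps)
  qed
  then have *: "A n * (pochhammer p n / pochhammer (p + 1) n) * s ^ n
      = p * (A n / (p + real n) * s ^ n)" for n s by simp
  have summ: "summable (\<lambda>n. A n / (p + real n) * s ^ n)" for s
  proof -
    have "summable (\<lambda>n. p * (A n / (p + real n) * s ^ n))"
      using beta_multiplier[OF A p, of 1] by (simp only: pos_series_def * zero_le_one)
    then show ?thesis by (rule summable_mult_D) (use p in simp)
  qed
  have pos: "(\<Sum>n. A n / (p + real n) * s ^ n) > 0" if "s \<ge> 0" for s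
    using beta_multiplier_pos[OF A p zero_less_one that] p
    unfolding * suminf_mult[OF summ] by (simp add: zero_less_mult_iff)
  show "pos_series (\<lambda>n. A n / (p + real n))"
    using A p pos summ by (auto simp: pos_series_def intro: less_imp_le)
  show "s \<ge> 0 \<Longrightarrow> (\<Sum>n. A n / (p + real n) * s ^ n) > 0" by (rule pos)
qed

subsection \<open>The square of a Bessel function\<close>

text \<open>Multiplying each summand by (c)_n^2 turns it into a product of two generalised binomial
  coefficients with upper entry c+n-1; Vandermonde's identity sums them.\<close>

lemma pochhammer_convolution:
  fixes c :: real
  assumes "c > 0"
  shows "(\<Sum>k\<le>n. 1 / (fact k * pochhammer c k) * (1 / (fact (n - k) * pochhammer c (n - k))))
     = pochhammer (2 * c + real n - 1) n / (fact n * pochhammer c n * pochhammer c n)"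
proof -
  have pos: "pochhammer c k > 0" for k using assms by (rule pochhammer_pos)
  have "1 / (fact k * pochhammer c k) * (1 / (fact (n - k) * pochhammer c (n - k)))
      = ((c + real n - 1) gchoose k) * ((c + real n - 1) gchoose (n - k))
          / (pochhammer c n * pochhammer c n)" if "k \<le> n" for k
  proof -
    \<comment> \<open>Splitting (c)_n at n-k and at k yields the two denominators as initial pieces;
      the final pieces are the numerators of the binomial coefficients.\<close>
    have 1: "pochhammer c n = pochhammer c (n - k) * pochhammer (c + real (n - k)) k"
      using pochhammer_product[of "n - k" n c] that by simp
    have 2: "pochhammer c n = pochhammer c k * pochhammer (c + real k) (n - k)"
      using pochhammer_product[of k n c] that by simp
    have 3: "(c + real n - 1) gchoose k = pochhammer (c + real (n - k)) k / fact k"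
      using that by (simp add: gbinomial_pochhammer' of_nat_diff algebra_simps)
    have 4: "(c + real n - 1) gchoose (n - k) = pochhammer (c + real k) (n - k) / fact (n - k)"
      using that by (simp add: gbinomial_pochhammer' of_nat_diff algebra_simps)
    have "pochhammer c n * pochhammer c n = (pochhammer c k * pochhammer (c + real k) (n - k))
        * (pochhammer c (n - k) * pochhammer (c + real (n - k)) k)"
      by (simp flip: 1 2)
    moreover have "pochhammer (c + real k) (n - k) > 0" "pochhammer (c + real (n - k)) k > 0"
      using assms by (auto intro!: pochhammer_pos)
    ultimately show ?thesis by (simp add: 3 4)
  qed
  then have "(\<Sum>k\<le>n. 1 / (fact k * pochhammer c k) * (1 / (fact (n - k) * pochhammer c (n - k))))
     = (\<Sum>k\<le>n. ((c + real n - 1) gchoose k) * ((c + real n - 1) gchoose (n - k)))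
          / (pochhammer c n * pochhammer c n)"
    by (simp add: sum_divide_distrib)
  also have "(\<Sum>k\<le>n. ((c + real n - 1) gchoose k) * ((c + real n - 1) gchoose (n - k)))
      = ((c + real n - 1) + (c + real n - 1)) gchoose n"
    by (simp only: gbinomial_Vandermonde atMost_atLeast0)
  also have "\<dots> = pochhammer (2 * c + real n - 1) n / fact n"
  proof -
    have "(c + real n - 1) + (c + real n - 1) - real n + 1 = 2 * c + real n - 1" by simp
    then show ?thesis by (simp only: gbinomial_pochhammer')
  qed
  finally show ?thesis by simp
qed

text \<open>The convolution with c = a+1/2 leaves (2a+n)_n, which the duplication formula for
  (2a)_{2n} rewrites; the power of 4 it produces cancels the one on the left.\<close>

lemma square_0F1_coeff:
  fixes a :: real
  assumes "a > 0"
  shows "(\<Sum>k\<le>n. 1 / (fact k * pochhammer (a + 1/2) k)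
            * (1 / (fact (n - k) * pochhammer (a + 1/2) (n - k)))) / 4 ^ n
     = pochhammer a n / (fact n * (pochhammer (a + 1/2) n * pochhammer (2 * a) n))"
proof -
  have n2: "n + n = 2 * n" by simp
  have "pochhammer (2 * a) n * pochhammer (2 * a + real n) n = pochhammer (2 * a) (2 * n)"
    unfolding n2[symmetric] by (rule pochhammer_product'[symmetric])
  also have "\<dots> = 4 ^ n * pochhammer a n * pochhammer (a + 1/2) n"
    unfolding pochhammer_double by (simp add: power_mult)
  finally have *: "pochhammer (2 * a) n * pochhammer (2 * a + real n) n
     = 4 ^ n * pochhammer a n * pochhammer (a + 1/2) n" .
  have pos: "pochhammer (2 * a) n > 0" "pochhammer (a + 1/2) n > 0"
    using assms by (auto intro!: pochhammer_pos)
  have c: "2 * (a + 1/2) + real n - 1 = 2 * a + real n" and "a + 1/2 > 0" using assms by simp_all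
  have "pochhammer (2 * a + real n) n = 4 ^ n * pochhammer a n * pochhammer (a + 1/2) n / pochhammer (2 * a) n"
    using * pos by (simp add: field_simps)
  then show ?thesis
    unfolding pochhammer_convolution[OF \<open>a + 1/2 > 0\<close>] c using pos by simp
qed

text \<open>Every factor after the first is at least 1, so only c itself can pull the product below
  1. This bounds 1/(c)_n, so that the 0F1 series is dominated by an exponential series.\<close>

lemma pochhammer_ge_min_1:
  fixes c :: real
  assumes "c > 0"
  shows "min 1 c \<le> pochhammer c n"
proof (induction n)
  case (Suc n)
  show ?case
  proof (cases n)
    case (Suc k)
    have "pochhammer c n * 1 \<le> pochhammer c n * (c + real n)"
      using assms Suc by (intro mult_left_mono less_imp_le[OF pochhammer_pos]) auto
    with Suc.IH show ?thesis by (simp add: pochhammer_Suc)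
  qed simp
qed simp

text \<open>The Cauchy product exhibits the sum as a square, hence nonnegative.\<close>

lemma pos_series_1F2_square:
  fixes a :: real
  assumes a: "a > 0"
  shows "pos_series (\<lambda>n. (-1) ^ n * (pochhammer a n / (fact n * (pochhammer (a + 1/2) n * pochhammer (2 * a) n))))"
proof -
  define V where "V = (\<lambda>n. (-1) ^ n * (pochhammer a n / (fact n * (pochhammer (a + 1/2) n * pochhammer (2 * a) n))))"
  \<comment> \<open>The coefficients in s of 0F1(; a+1/2; -s/4), a normalised Bessel function at s =
    x^2.\<close>
  define U where "U = (\<lambda>n. (-1/4) ^ n * (1 / (fact n * pochhammer (a + 1/2) n)))"
  have conv: "V n = (\<Sum>k\<le>n. U k * U (n - k))" for n
  proof -
    have "U k * U (n - k) = (-1/4) ^ n * (1 / (fact k * pochhammer (a + 1/2) k)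
            * (1 / (fact (n - k) * pochhammer (a + 1/2) (n - k))))" if "k \<le> n" for k
    proof -
      have "(-1/4 :: real) ^ k * (-1/4) ^ (n - k) = (-1/4) ^ n"
        using that by (simp flip: power_add)
      moreover have "U k * U (n - k) = ((-1/4) ^ k * (-1/4) ^ (n - k))
          * (1 / (fact k * pochhammer (a + 1/2) k) * (1 / (fact (n - k) * pochhammer (a + 1/2) (n - k))))"
        by (simp only: U_def mult_ac)
      ultimately show ?thesis by simp
    qed
    then have "(\<Sum>k\<le>n. U k * U (n - k)) = (-1/4) ^ n * (\<Sum>k\<le>n. 1 / (fact k * pochhammer (a + 1/2) k)
            * (1 / (fact (n - k) * pochhammer (a + 1/2) (n - k))))"
      by (simp add: sum_distrib_left)
    also have "(-1/4 :: real) ^ n = (-1) ^ n / 4 ^ n" by (simp only: power_divide)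
    finally show ?thesis unfolding V_def square_0F1_coeff[OF a, symmetric] by simp
  qed
  have "summable (\<lambda>n. ((-1/4) ^ n / fact n * (1 / pochhammer (a + 1/2) n)) * s ^ n)" for s :: real
  proof (rule entire_mult_bounded)
    show "summable (\<lambda>n. ((-1/4) ^ n / fact n) * s ^ n)" for s :: real
      using summable_exp[of "(-1/4) * s"]
      by (simp only: power_mult_distrib divide_inverse mult_ac)
    show "\<bar>1 / pochhammer (a + 1/2) n\<bar> \<le> 1 / min 1 (a + 1/2)" for n
      using pochhammer_ge_min_1[of "a + 1/2" n] pochhammer_pos[of "a + 1/2" n] a
      by (auto intro!: divide_left_mono)
  qed
  then have sU: "summable (\<lambda>n. \<bar>U n * s ^ n\<bar>)" for s
    by (intro entire_abs_summable) (simp add: U_def)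
  have "(\<lambda>n. V n * s ^ n) sums ((\<Sum>n. U n * s ^ n) * (\<Sum>n. U n * s ^ n))" for s
  proof -
    have "(\<lambda>n. \<Sum>k\<le>n. (U k * s ^ k) * (U (n - k) * s ^ (n - k)))
        sums ((\<Sum>n. U n * s ^ n) * (\<Sum>n. U n * s ^ n))"
      using sU[of s] by (intro Cauchy_product_sums) simp_all
    moreover have "(\<Sum>k\<le>n. (U k * s ^ k) * (U (n - k) * s ^ (n - k))) = V n * s ^ n" for n
    proof -
      have "(U k * s ^ k) * (U (n - k) * s ^ (n - k)) = U k * U (n - k) * s ^ n" if "k \<le> n" for k
      proof -
        have "s ^ k * s ^ (n - k) = s ^ n" using that by (simp flip: power_add)
        moreover have "(U k * s ^ k) * (U (n - k) * s ^ (n - k)) = U k * U (n - k) * (s ^ k * s ^ (n - k))"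
          by (simp only: mult_ac)
        ultimately show ?thesis by simp
      qed
      then show ?thesis unfolding conv sum_distrib_right by (intro sum.cong) simp_all
    qed
    ultimately show ?thesis by (simp only:)
  qed
  then have "summable (\<lambda>n. V n * s ^ n)" "(\<Sum>n. V n * s ^ n) = (\<Sum>n. U n * s ^ n) * (\<Sum>n. U n * s ^ n)" for s
    by (simp_all only: sums_iff)
  moreover have "V 0 > 0" by (simp add: V_def)
  ultimately have "pos_series V" unfolding pos_series_def by simp
  then show ?thesis by (simp add: V_def)
qed

subsection \<open>Majorized parameters\<close>

text \<open>Here \<open>A'\<close> is \<open>A\<close> plus \<open>\<beta>\<close> and
  \<open>\<gamma>\<close> times sequences obtained from \<open>A\<close> by successive inverse
  linear multipliers. Their sums are nonnegative, and the one attached to \<open>\<beta>\<close> is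
  strictly positive.\<close>

lemma quadratic_cubic_multiplier:
  assumes A: "pos_series A" and pqr: "p > 0" "q > 0" "r > 0" and "\<beta> \<ge> 0" "\<gamma> \<ge> 0"
  defines "A' \<equiv> (\<lambda>n. A n * (1 + \<beta> / ((q + real n) * (r + real n))
                        + \<gamma> / ((p + real n) * (q + real n) * (r + real n))))"
  shows "pos_series A'"
    and "s \<ge> 0 \<Longrightarrow> (\<Sum>n. A n * s ^ n) \<le> (\<Sum>n. A' n * s ^ n)"
    and "s \<ge> 0 \<Longrightarrow> \<beta> > 0 \<Longrightarrow> (\<Sum>n. A' n * s ^ n) > 0"
proof -
  define B where "B = (\<lambda>n. A n / (q + real n) / (r + real n))"
  define C where "C = (\<lambda>n. B n / (p + real n))"
  have Aq: "pos_series (\<lambda>n. A n / (q + real n))"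
    using inverse_linear_multiplier(1)[OF A] pqr by simp
  have B: "pos_series B" unfolding B_def
    using inverse_linear_multiplier(1)[OF Aq] pqr by simp
  have C: "pos_series C" unfolding C_def
    using inverse_linear_multiplier(1)[OF B] pqr by simp
  have Bpos: "(\<Sum>n. B n * s ^ n) > 0" if "s \<ge> 0" for s
    unfolding B_def using inverse_linear_multiplier(2)[OF Aq _ that] pqr by simp
  have Cnn: "(\<Sum>n. C n * s ^ n) \<ge> 0" if "s \<ge> 0" for s
    using C that by (simp add: pos_series_def)
  have "A' n = A n + \<beta> * B n + \<gamma> * C n" for n
    by (simp add: A'_def B_def C_def field_simps)
  then have *: "A' n * s ^ n = A n * s ^ n + \<beta> * (B n * s ^ n) + \<gamma> * (C n * s ^ n)" for n s
    by (simp add: algebra_simps)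
  have sums: "(\<lambda>n. A' n * s ^ n) sums
     ((\<Sum>n. A n * s ^ n) + \<beta> * (\<Sum>n. B n * s ^ n) + \<gamma> * (\<Sum>n. C n * s ^ n))" for s
    unfolding * using A B C
    by (intro sums_add sums_mult summable_sums) (auto simp: pos_series_def)
  have eq: "(\<Sum>n. A' n * s ^ n)
     = (\<Sum>n. A n * s ^ n) + \<beta> * (\<Sum>n. B n * s ^ n) + \<gamma> * (\<Sum>n. C n * s ^ n)" for s
    using sums[of s] by (simp add: sums_iff)
  show le: "(\<Sum>n. A n * s ^ n) \<le> (\<Sum>n. A' n * s ^ n)" if "s \<ge> 0" for s
    using Bpos[OF that] Cnn[OF that] assms(5,6) by (simp add: eq)
  have Ann: "0 \<le> (\<Sum>n. A n * s ^ n)" if "s \<ge> 0" for s using A that by (simp add: pos_series_def)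
  show "(\<Sum>n. A' n * s ^ n) > 0" if "s \<ge> 0" "\<beta> > 0"
    unfolding eq using mult_pos_pos[OF \<open>\<beta> > 0\<close> Bpos[OF that(1)]] Cnn[OF that(1)] assms(6) Ann[OF that(1)]
    by (intro add_pos_nonneg add_nonneg_pos) auto
  have "A' 0 > 0"
    using A pqr assms(5,6) unfolding A'_def
    by (intro mult_pos_pos) (auto simp: pos_series_def intro!: add_pos_nonneg)
  then show "pos_series A'"
    using sums le Ann order_trans unfolding pos_series_def by (blast dest: sums_summable)
qed

text \<open>Equal parameter sums cancel the x^2 terms, so numerator minus denominator is linear in
  x. Its slope is the difference of the second elementary symmetric functions, here half the
  difference of the sums of squares; its value at x = -p is the product of the
  \<open>hi - p\<close>.\<close>

lemma cubic_ratio_expansion: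
  fixes p q r h1 h2 h3 x :: real
  assumes "h1 + h2 + h3 = p + q + r" and "p + x > 0" "q + x > 0" "r + x > 0"
  shows "((h1 + x) * (h2 + x) * (h3 + x)) / ((p + x) * (q + x) * (r + x))
    = 1 + ((p\<^sup>2 + q\<^sup>2 + r\<^sup>2 - (h1\<^sup>2 + h2\<^sup>2 + h3\<^sup>2)) / 2) / ((q + x) * (r + x))
        + ((h1 - p) * (h2 - p) * (h3 - p)) / ((p + x) * (q + x) * (r + x))"
proof -
  have h3: "h3 = p + q + r - h1 - h2" using assms(1) by simp
  have "(h1 + x) * (h2 + x) * (h3 + x) = (p + x) * (q + x) * (r + x)
     + (p\<^sup>2 + q\<^sup>2 + r\<^sup>2 - (h1\<^sup>2 + h2\<^sup>2 + h3\<^sup>2)) / 2 * (p + x) + (h1 - p) * (h2 - p) * (h3 - p)"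
    unfolding h3 by (simp add: power2_eq_square field_simps)
  then have "((h1 + x) * (h2 + x) * (h3 + x)) / ((p + x) * (q + x) * (r + x))
     = ((p + x) * (q + x) * (r + x)
     + (p\<^sup>2 + q\<^sup>2 + r\<^sup>2 - (h1\<^sup>2 + h2\<^sup>2 + h3\<^sup>2)) / 2 * (p + x) + (h1 - p) * (h2 - p) * (h3 - p))
       / ((p + x) * (q + x) * (r + x))"
    by simp
  also have "\<dots> = 1 + ((p\<^sup>2 + q\<^sup>2 + r\<^sup>2 - (h1\<^sup>2 + h2\<^sup>2 + h3\<^sup>2)) / 2) / ((q + x) * (r + x))
        + ((h1 - p) * (h2 - p) * (h3 - p)) / ((p + x) * (q + x) * (r + x))"
    using assms(2-4) by (simp only: add_divide_distrib) simp
  finally show ?thesis .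
qed

text \<open>Euler's limit for Gamma, N! N^z / (z)_{N+1}, is taken for all six parameters; equal sums
  make the factorials and powers of N cancel. The index \<open>Suc N\<close> comes from this
  limit.\<close>

lemma pochhammer_ratio_tendsto:
  fixes p q r h1 h2 h3 :: real
  assumes sum: "h1 + h2 + h3 = p + q + r" and pos: "p > 0" "q > 0" "r > 0" "h1 > 0" "h2 > 0" "h3 > 0"
  shows "(\<lambda>N. (pochhammer h1 (Suc N) * pochhammer h2 (Suc N) * pochhammer h3 (Suc N))
            / (pochhammer p (Suc N) * pochhammer q (Suc N) * pochhammer r (Suc N)))
         \<longlonglongrightarrow> (Gamma p * Gamma q * Gamma r) / (Gamma h1 * Gamma h2 * Gamma h3)"
proof -
  have "(\<lambda>N. (Gamma_series p N * Gamma_series q N * Gamma_series r N)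
             / (Gamma_series h1 N * Gamma_series h2 N * Gamma_series h3 N))
         \<longlonglongrightarrow> (Gamma p * Gamma q * Gamma r) / (Gamma h1 * Gamma h2 * Gamma h3)"
    using pos[THEN Gamma_real_pos] by (intro tendsto_intros) auto
  moreover have "(Gamma_series p N * Gamma_series q N * Gamma_series r N)
             / (Gamma_series h1 N * Gamma_series h2 N * Gamma_series h3 N)
     = (pochhammer h1 (Suc N) * pochhammer h2 (Suc N) * pochhammer h3 (Suc N))
            / (pochhammer p (Suc N) * pochhammer q (Suc N) * pochhammer r (Suc N))" for N
  proof -
    define l where "l = ln (real N)"
    have "exp (p * l) * exp (q * l) * exp (r * l) = exp ((p + q + r) * l)"
      by (simp add: exp_add distrib_right)
    also have "\<dots> = exp (h1 * l) * exp (h2 * l) * exp (h3 * l)"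
      unfolding sum[symmetric] by (simp add: exp_add distrib_right)
    finally have E: "exp (p * l) * exp (q * l) * exp (r * l) = exp (h1 * l) * exp (h2 * l) * exp (h3 * l)" .
    have P: "pochhammer p (Suc N) > 0" "pochhammer q (Suc N) > 0" "pochhammer r (Suc N) > 0"
      "pochhammer h1 (Suc N) > 0" "pochhammer h2 (Suc N) > 0" "pochhammer h3 (Suc N) > 0"
      using pos by (auto intro: pochhammer_pos)
    have "(Gamma_series p N * Gamma_series q N * Gamma_series r N)
             / (Gamma_series h1 N * Gamma_series h2 N * Gamma_series h3 N)
       = ((fact N) ^ 3 * (exp (p * l) * exp (q * l) * exp (r * l)))
            / (pochhammer p (Suc N) * pochhammer q (Suc N) * pochhammer r (Suc N))
         / (((fact N) ^ 3 * (exp (h1 * l) * exp (h2 * l) * exp (h3 * l)))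
            / (pochhammer h1 (Suc N) * pochhammer h2 (Suc N) * pochhammer h3 (Suc N)))"
      by (simp add: Gamma_series_def l_def power3_eq_cube mult_ac)
    also have "\<dots> = (pochhammer h1 (Suc N) * pochhammer h2 (Suc N) * pochhammer h3 (Suc N))
            / (pochhammer p (Suc N) * pochhammer q (Suc N) * pochhammer r (Suc N))"
      unfolding E by simp
    finally show ?thesis .
  qed
  ultimately show ?thesis by simp
qed

text \<open>The factors \<open>M m\<close> are applied one after another. Each preserves
  \<open>pos_series\<close> and does not decrease the sum, and their infinite product is the wanted
  ratio up to the constant \<open>D 0\<close>.\<close>

lemma majorization_multiplier:
  assumes A: "pos_series A" and pqr: "p > 0" "q > 0" "r > 0"
    and h: "h1 \<ge> p" "h2 \<ge> p" "h3 \<ge> p"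
    and sum: "h1 + h2 + h3 = p + q + r"
    and sq: "h1\<^sup>2 + h2\<^sup>2 + h3\<^sup>2 \<le> p\<^sup>2 + q\<^sup>2 + r\<^sup>2"
  defines "W \<equiv> (\<lambda>n. A n * ((pochhammer p n * pochhammer q n * pochhammer r n)
                          / (pochhammer h1 n * pochhammer h2 n * pochhammer h3 n)))"
  shows "pos_series W"
    and "h1\<^sup>2 + h2\<^sup>2 + h3\<^sup>2 < p\<^sup>2 + q\<^sup>2 + r\<^sup>2 \<Longrightarrow> s \<ge> 0 \<Longrightarrow> (\<Sum>n. W n * s ^ n) > 0"
proof -
  define \<beta> where "\<beta> = (p\<^sup>2 + q\<^sup>2 + r\<^sup>2 - (h1\<^sup>2 + h2\<^sup>2 + h3\<^sup>2)) / 2"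
  define \<gamma> where "\<gamma> = (h1 - p) * (h2 - p) * (h3 - p)"
  have \<beta>: "\<beta> \<ge> 0" and \<gamma>: "\<gamma> \<ge> 0" using sq h by (auto simp: \<beta>_def \<gamma>_def)
  define M where "M = (\<lambda>m n. 1 + \<beta> / ((q + real m + real n) * (r + real m + real n))
     + \<gamma> / ((p + real m + real n) * (q + real m + real n) * (r + real m + real n)))"
  define G where "G = (\<lambda>N n. A n * (\<Prod>m<N. M m n))"
  define D where "D = (\<lambda>n. (Gamma (p + real n) * Gamma (q + real n) * Gamma (r + real n))
     / (Gamma (h1 + real n) * Gamma (h2 + real n) * Gamma (h3 + real n)))"
  have G_Suc: "G (Suc N) = (\<lambda>n. G N n * M N n)" for N by (simp add: G_def mult_ac)
  have posG: "pos_series (G N)" for N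
  proof (induction N)
    case 0
    show ?case using A by (simp add: G_def)
  next
    case (Suc N)
    show ?case unfolding G_Suc M_def
      using pqr by (intro quadratic_cubic_multiplier(1) Suc \<beta> \<gamma>) auto
  qed
  have G_mono: "(\<Sum>n. G N n * s ^ n) \<le> (\<Sum>n. G (Suc N) n * s ^ n)" if "s \<ge> 0" for N s
    unfolding G_Suc M_def
    using pqr that by (intro quadratic_cubic_multiplier(2) posG \<beta> \<gamma>) auto
  \<comment> \<open>The comparison starts at \<open>G 1\<close> because the strict gain from
    \<open>\<beta> > 0\<close> is already present after one factor and so survives the
    limit.\<close>
  have G_1_le: "(\<Sum>n. G 1 n * s ^ n) \<le> (\<Sum>n. G (Suc N) n * s ^ n)" if "s \<ge> 0" for N s
    using lift_Suc_mono_le[of "\<lambda>N. \<Sum>n. G N n * s ^ n", OF G_mono[OF that], of 1 "Suc N"] by simp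
  have M_ge_1: "M m n \<ge> 1" for m n
    using pqr \<beta> \<gamma> by (simp add: M_def)
  \<comment> \<open>The factors decrease in n, so the convergent products at n = 0 give a bound
    uniform in both n and N, as Tannery's theorem requires.\<close>
  have M_le: "M m n \<le> M m 0" for m n
    unfolding M_def using pqr \<beta> \<gamma>
    by (intro add_mono divide_left_mono mult_mono order_refl mult_pos_pos mult_nonneg_nonneg) auto
  have M_prod: "(\<Prod>m<N. M m n) = (pochhammer (h1 + real n) N * pochhammer (h2 + real n) N * pochhammer (h3 + real n) N)
            / (pochhammer (p + real n) N * pochhammer (q + real n) N * pochhammer (r + real n) N)" for N n
  proof -
    have "M m n = ((h1 + real n + real m) * (h2 + real n + real m) * (h3 + real n + real m))
        / ((p + real n + real m) * (q + real n + real m) * (r + real n + real m))" for m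
      using cubic_ratio_expansion[OF sum, of "real n + real m"] pqr
      by (simp add: M_def \<beta>_def \<gamma>_def add_ac)
    then show ?thesis
      by (simp add: pochhammer_prod prod_dividef prod.distrib lessThan_atLeast0)
  qed
  \<comment> \<open>The limit inverts the roles: the \<open>h\<close> symbols stand in the numerator
    of the finite product but in the denominator of \<open>D n\<close>.\<close>
  have prod_lim: "(\<lambda>N. \<Prod>m<Suc N. M m n) \<longlonglongrightarrow> D n" for n
    unfolding M_prod D_def using sum pqr h by (intro pochhammer_ratio_tendsto) auto
  have "Bseq (\<lambda>N. \<Prod>m<Suc N. M m 0)" using prod_lim[of 0] by (rule convergentI[THEN convergent_imp_Bseq])
  then obtain C where C: "\<And>N. norm (\<Prod>m<Suc N. M m 0) \<le> C" by (auto simp: Bseq_def)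
  have bound: "norm (G (Suc N) n * s ^ n) \<le> C * \<bar>A n * s ^ n\<bar>" for N n s
  proof -
    have "0 \<le> (\<Prod>m<Suc N. M m n)"
      using M_ge_1 by (intro prod_nonneg) (meson order_trans zero_le_one)
    moreover have "(\<Prod>m<Suc N. M m n) \<le> (\<Prod>m<Suc N. M m 0)"
      using M_ge_1 M_le by (intro prod_mono) (meson order_trans zero_le_one)
    ultimately have "\<bar>\<Prod>m<Suc N. M m n\<bar> \<le> C" using C[of N] by simp
    then have "\<bar>A n * s ^ n\<bar> * \<bar>\<Prod>m<Suc N. M m n\<bar> \<le> \<bar>A n * s ^ n\<bar> * C"
      by (intro mult_left_mono) auto
    then show ?thesis by (simp add: G_def abs_mult mult_ac)
  qed
  have sumA: "summable (\<lambda>n. C * \<bar>A n * s ^ n\<bar>)" for s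
    using A by (intro summable_mult entire_abs_summable) (simp add: pos_series_def)
  have lim1: "(\<lambda>N. G (Suc N) n * s ^ n) \<longlonglongrightarrow> A n * D n * s ^ n" for n s
    unfolding G_def by (intro tendsto_intros prod_lim)
  have tan: "summable (\<lambda>n. norm (A n * D n * s ^ n)) \<and>
     (\<lambda>N. \<Sum>n. G (Suc N) n * s ^ n) \<longlonglongrightarrow> (\<Sum>n. A n * D n * s ^ n)" for s
  proof -
    have "\<forall>\<^sub>F (n, N) in sequentially \<times>\<^sub>F sequentially. norm (G (Suc N) n * s ^ n) \<le> C * \<bar>A n * s ^ n\<bar>"
      using bound by (intro always_eventually) (auto simp del: real_norm_def)
    from tannerys_theorem[OF lim1 this sumA] show ?thesis by simp
  qed
  have ge: "(\<Sum>n. G 1 n * s ^ n) \<le> (\<Sum>n. A n * D n * s ^ n)" if "s \<ge> 0" for s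
    using tan[of s] G_1_le[OF that] by (intro LIMSEQ_le_const) auto
  have D0: "D 0 > 0" using pqr h by (simp add: D_def)
  have D: "D n = D 0 * ((pochhammer p n * pochhammer q n * pochhammer r n)
                          / (pochhammer h1 n * pochhammer h2 n * pochhammer h3 n))" for n
    using pqr h Gamma_plus_nat[of p n] Gamma_plus_nat[of q n] Gamma_plus_nat[of r n]
      Gamma_plus_nat[of h1 n] Gamma_plus_nat[of h2 n] Gamma_plus_nat[of h3 n]
    by (simp add: D_def mult_ac)
  have W: "A n * D n = D 0 * W n" for n unfolding D[of n] W_def by simp
  have sW: "summable (\<lambda>n. W n * s ^ n)" for s
  proof -
    have "summable (\<lambda>n. D 0 * (W n * s ^ n))"
      using tan[of s, THEN conjunct1, THEN summable_norm_cancel] by (simp add: W mult.assoc)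
    then show ?thesis by (rule summable_mult_D) (use D0 in simp)
  qed
  have ge': "(\<Sum>n. G 1 n * s ^ n) \<le> D 0 * (\<Sum>n. W n * s ^ n)" if "s \<ge> 0" for s
    using ge[OF that] suminf_mult[OF sW[of s], of "D 0"] by (simp add: W mult.assoc)
  have "0 \<le> (\<Sum>n. G 1 n * s ^ n)" if "s \<ge> 0" for s using posG[of 1] that by (simp add: pos_series_def)
  then have "0 \<le> D 0 * (\<Sum>n. W n * s ^ n)" if "s \<ge> 0" for s using ge' that by (meson order_trans)
  then have "0 \<le> (\<Sum>n. W n * s ^ n)" if "s \<ge> 0" for s using D0 that by (simp add: zero_le_mult_iff)
  moreover have "W 0 > 0" using A by (simp add: W_def pos_series_def)
  ultimately show "pos_series W" using sW by (simp add: pos_series_def)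
  assume strict: "h1\<^sup>2 + h2\<^sup>2 + h3\<^sup>2 < p\<^sup>2 + q\<^sup>2 + r\<^sup>2" and s: "s \<ge> 0"
  have "G 1 = (\<lambda>n. A n * (1 + \<beta> / ((q + real n) * (r + real n))
                        + \<gamma> / ((p + real n) * (q + real n) * (r + real n))))"
    by (simp add: G_def M_def)
  then have "(\<Sum>n. G 1 n * s ^ n) > 0"
    using quadratic_cubic_multiplier(3)[OF A pqr \<beta> \<gamma> s] strict by (simp add: \<beta>_def)
  then have "D 0 * (\<Sum>n. W n * s ^ n) > 0" using ge'[OF s] by simp
  then show "(\<Sum>n. W n * s ^ n) > 0" using D0 by (simp add: zero_less_mult_iff)
qed

subsection \<open>Newton polyhedra of permutations\<close>

text \<open>Three Beta averages, one for each parameter.\<close>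

lemma raise_parameters_multiplier:
  assumes A: "pos_series A" and h: "h1 > 0" "h2 > 0" "h3 > 0" and b: "h1 \<le> b1" "h2 \<le> b2" "h3 \<le> b3"
  defines "W \<equiv> (\<lambda>n. A n * ((pochhammer h1 n * pochhammer h2 n * pochhammer h3 n)
                          / (pochhammer b1 n * pochhammer b2 n * pochhammer b3 n)))"
  shows "pos_series W"
    and "(b1, b2, b3) \<noteq> (h1, h2, h3) \<Longrightarrow> s \<ge> 0 \<Longrightarrow> (\<Sum>n. W n * s ^ n) > 0"
proof -
  have raise: "pos_series (\<lambda>n. B n * (pochhammer h n / pochhammer b n))"
    if "pos_series B" "h > 0" "h \<le> b" for B h b
    using beta_multiplier[of B h "b - h"] that by simp
  have strict: "(\<Sum>n. B n * (pochhammer h n / pochhammer b n) * s ^ n) > 0"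
    if "pos_series B" "h > 0" "h \<le> b" "b \<noteq> h" "s \<ge> 0" for B h b s
    using beta_multiplier_pos[of B h "b - h" s] that by simp
  \<comment> \<open>Three orderings of the same product: strictness is read off from the last
    average, so a parameter that really increases must come last.\<close>
  have W: "W n = A n * (pochhammer h1 n / pochhammer b1 n) * (pochhammer h2 n / pochhammer b2 n)
     * (pochhammer h3 n / pochhammer b3 n)"
    "W n = A n * (pochhammer h1 n / pochhammer b1 n) * (pochhammer h3 n / pochhammer b3 n)
     * (pochhammer h2 n / pochhammer b2 n)"
    "W n = A n * (pochhammer h2 n / pochhammer b2 n) * (pochhammer h3 n / pochhammer b3 n)
     * (pochhammer h1 n / pochhammer b1 n)" for n
    by (simp_all add: W_def mult_ac)
  show "pos_series W" unfolding W(1)[abs_def] by (intro raise A h b)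
  assume "(b1, b2, b3) \<noteq> (h1, h2, h3)" and s: "s \<ge> 0"
  then consider "b1 \<noteq> h1" | "b2 \<noteq> h2" | "b3 \<noteq> h3" by auto
  then show "(\<Sum>n. W n * s ^ n) > 0"
  proof cases
    case 1
    then show ?thesis unfolding W(3) by (intro strict raise A h b s)
  next
    case 2
    then show ?thesis unfolding W(2) by (intro strict raise A h b s)
  next
    case 3
    then show ?thesis unfolding W(1) by (intro strict raise A h b s)
  qed
qed

text \<open>The Minkowski sum of the hull of \<open>E\<close> and the orthant is convex and contains
  every translated orthant, hence the whole polyhedron.\<close>

lemma newton_polyhedron_imp_hull:
  assumes "b \<in> newton_polyhedron E"
  obtains h where "h \<in> convex hull E" "\<And>i. h $ i \<le> b $ i"
proof -
  define S where "S = {h + y | h y. h \<in> convex hull E \<and> y \<in> nonneg_orthant}"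
  have "convex (nonneg_orthant :: (real ^ 'a) set)"
    by (auto simp: convex_def nonneg_orthant_def)
  then have "convex (\<Union>x\<in>convex hull E. \<Union>y\<in>nonneg_orthant. {x + y})"
    by (intro convex_sums) auto
  also have "(\<Union>x\<in>convex hull E. \<Union>y\<in>nonneg_orthant. {x + y}) = S"
    by (auto simp: S_def)
  finally have "convex S" .
  moreover have "(\<Union>x\<in>E. (\<lambda>y. x + y) ` nonneg_orthant) \<subseteq> S"
    by (auto simp: S_def intro!: hull_inc)
  ultimately have "newton_polyhedron E \<subseteq> S"
    unfolding newton_polyhedron_def by (intro hull_minimal)
  with assms obtain h y where "b = h + y" "h \<in> convex hull E" "y \<in> nonneg_orthant"
    by (auto simp: S_def)
  then show ?thesis using that by (auto simp: nonneg_orthant_def)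
qed

section \<open>Symmetric invariants and the hull of permutations\<close>

lemma coord_permutations_invariants:
  fixes v :: "real ^ 'n"
  assumes "w \<in> coord_permutations v"
  shows "(\<Sum>i\<in>UNIV. w $ i) = (\<Sum>i\<in>UNIV. v $ i)" and "w \<bullet> w = v \<bullet> v"
    and "\<And>i. Min (range (($) v)) \<le> w $ i"
proof -
  obtain p where p: "p permutes UNIV" and w: "w = (\<chi> i. v $ p i)"
    using assms by (auto simp: coord_permutations_def)
  show "(\<Sum>i\<in>UNIV. w $ i) = (\<Sum>i\<in>UNIV. v $ i)"
    using sum.permute[OF p, of "($) v"] by (simp add: w o_def)
  show "w \<bullet> w = v \<bullet> v"
    using sum.permute[OF p, of "\<lambda>i. v $ i * v $ i"] by (simp add: w o_def inner_vec_def)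
  show "Min (range (($) v)) \<le> w $ i" for i by (simp add: w)
qed

text \<open>The first three bounds describe a hyperplane, half-spaces and a ball; these are convex
  and contain all permutations of \<open>v\<close>, hence their hull.\<close>

lemma hull_coord_permutations:
  fixes v h :: "real ^ 'n"
  assumes "h \<in> convex hull (coord_permutations v)"
  shows "(\<Sum>i\<in>UNIV. h $ i) = (\<Sum>i\<in>UNIV. v $ i)"
    and "\<And>i. Min (range (($) v)) \<le> h $ i"
    and "h \<bullet> h \<le> v \<bullet> v"
    and "h \<notin> coord_permutations v \<Longrightarrow> h \<bullet> h < v \<bullet> v"
proof -
  have hull: "h \<in> S" if "convex S" "\<And>w. w \<in> coord_permutations v \<Longrightarrow> w \<in> S" for S
    using assms hull_minimal[of "coord_permutations v" S convex] that by auto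
  have "convex {x :: real ^ 'n. (\<Sum>i\<in>UNIV. x $ i) = (\<Sum>i\<in>UNIV. v $ i)}"
    using convex_hyperplane[of "1 :: real ^ 'n" "\<Sum>i\<in>UNIV. v $ i"] by (simp add: inner_vec_def)
  then show "(\<Sum>i\<in>UNIV. h $ i) = (\<Sum>i\<in>UNIV. v $ i)"
    using hull coord_permutations_invariants(1)[of _ v] by fastforce
  show "Min (range (($) v)) \<le> h $ i" for i
  proof -
    have "convex {x :: real ^ 'n. Min (range (($) v)) \<le> x $ i}"
      using convex_halfspace_ge[of "Min (range (($) v))" "axis i 1 :: real ^ 'n"]
      by (simp add: inner_axis')
    then show ?thesis using hull coord_permutations_invariants(3)[of _ v] by fastforce
  qed
  show le: "h \<bullet> h \<le> v \<bullet> v"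
  proof -
    have "h \<in> cball 0 (norm v)"
      using coord_permutations_invariants(2)[of _ v] by (intro hull) (auto simp: norm_eq_sqrt_inner)
    then show ?thesis by (simp add: norm_eq_sqrt_inner)
  qed
  text \<open>If \<open>h\<close> is not a vertex, then every vertex \<open>w\<close> satisfies \<open>2 (h \<bullet> w) < h \<bullet> h + w \<bullet> w\<close>, so the
    vertices and hence \<open>h\<close> itself lie in an open half-space.\<close>
  show "h \<bullet> h < v \<bullet> v" if "h \<notin> coord_permutations v"
  proof -
    have "h \<in> {x. h \<bullet> x < v \<bullet> v}"
    proof (rule hull)
      show "convex {x. h \<bullet> x < v \<bullet> v}" by (rule convex_halfspace_lt)
      fix w assume w: "w \<in> coord_permutations v"
      then have "(h - w) \<bullet> (h - w) > 0" using that by auto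
      then show "w \<in> {x. h \<bullet> x < v \<bullet> v}"
        using le coord_permutations_invariants(2)[OF w] by (simp add: inner_diff inner_commute)
    qed
    then show ?thesis by simp
  qed
qed

lemma hull_coord_permutations_multiplier:
  assumes A: "pos_series A" and v: "v1 > 0" "v2 > 0" "v3 > 0"
    and h: "h \<in> convex hull (coord_permutations (vector [v1, v2, v3] :: real ^ 3))"
  defines "W \<equiv> (\<lambda>n. A n * ((pochhammer v1 n * pochhammer v2 n * pochhammer v3 n)
                          / (pochhammer (h $ 1) n * pochhammer (h $ 2) n * pochhammer (h $ 3) n)))"
  shows "\<And>i. h $ i > 0"
    and "pos_series W"
    and "h \<notin> coord_permutations (vector [v1, v2, v3]) \<Longrightarrow> s \<ge> 0 \<Longrightarrow> (\<Sum>n. W n * s ^ n) > 0"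
proof -
  let ?v = "vector [v1, v2, v3] :: real ^ 3"
  have m: "Min (range (($) ?v)) = min v1 (min v2 v3)"
    by (simp add: UNIV_3)
  note H = hull_coord_permutations[OF h]
  have ge: "min v1 (min v2 v3) \<le> h $ i" for i using H(2)[of i] by (simp add: m)
  show "h $ i > 0" for i using ge[of i] v by linarith
  have sum: "h $ 1 + h $ 2 + h $ 3 = v1 + v2 + v3" using H(1) by (simp add: sum_3)
  have sq: "(h $ 1)\<^sup>2 + (h $ 2)\<^sup>2 + (h $ 3)\<^sup>2 \<le> v1\<^sup>2 + v2\<^sup>2 + v3\<^sup>2"
    using H(3) by (simp add: inner_vec_def sum_3 power2_eq_square)
  have lt: "(h $ 1)\<^sup>2 + (h $ 2)\<^sup>2 + (h $ 3)\<^sup>2 < v1\<^sup>2 + v2\<^sup>2 + v3\<^sup>2" if "h \<notin> coord_permutations ?v"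
    using H(4)[OF that] by (simp add: inner_vec_def sum_3 power2_eq_square)
  \<comment> \<open>The majorization step singles out a least parameter \<open>p\<close>. Everything
    else is symmetric in the three entries of \<open>v\<close>, so they may be reordered with the
    smallest first.\<close>
  have *: "pos_series W \<and> (h \<notin> coord_permutations ?v \<longrightarrow> s \<ge> 0 \<longrightarrow> (\<Sum>n. W n * s ^ n) > 0)"
    if p: "p > 0" "q > 0" "r > 0" and pmin: "\<And>i. p \<le> h $ i"
      and s1: "p + q + r = v1 + v2 + v3" and s2: "p\<^sup>2 + q\<^sup>2 + r\<^sup>2 = v1\<^sup>2 + v2\<^sup>2 + v3\<^sup>2"
      and s3: "\<And>n. pochhammer p n * pochhammer q n * pochhammer r n
                  = pochhammer v1 n * pochhammer v2 n * pochhammer v3 n" for p q r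
  proof -
    note M = majorization_multiplier[OF A p pmin[of 1] pmin[of 2] pmin[of 3]
        sum[folded s1] sq[folded s2], unfolded s2 s3]
    show ?thesis using M(1) M(2)[OF lt] unfolding W_def by blast
  qed
  consider "v1 \<le> v2 \<and> v1 \<le> v3" | "v2 \<le> v1 \<and> v2 \<le> v3" | "v3 \<le> v1 \<and> v3 \<le> v2" by linarith
  then have "pos_series W \<and> (h \<notin> coord_permutations ?v \<longrightarrow> s \<ge> 0 \<longrightarrow> (\<Sum>n. W n * s ^ n) > 0)"
  proof cases
    case 1
    then show ?thesis using v by (intro *[of v1 v2 v3]) (auto intro!: order_trans[OF _ ge])
  next
    case 2
    then show ?thesis using v by (intro *[of v2 v1 v3]) (auto intro!: order_trans[OF _ ge])
  next
    case 3
    then show ?thesis using v by (intro *[of v3 v1 v2]) (auto intro!: order_trans[OF _ ge])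
  qed
  then show "pos_series W"
    and "h \<notin> coord_permutations ?v \<Longrightarrow> s \<ge> 0 \<Longrightarrow> (\<Sum>n. W n * s ^ n) > 0" by auto
qed

theorem theorem6p1:
  fixes a1 a2 b1 b2 b3 :: real
    and A :: "(real ^ 3) set"
    and \<Phi> :: "real \<Rightarrow> real"
  assumes "(a1, a2) \<in> Lambda_region"
    and "A = coord_permutations (vector [a2, a1 + 1/2, 2 * a1])"
    and "vector [b1, b2, b3] \<in> newton_polyhedron A"
    and "\<Phi> = (\<lambda>x. hypergeo_2F3 a1 a2 b1 b2 b3 (- (x ^ 2)))"
  shows "(\<forall>x>0. \<Phi> x \<ge> 0) \<and> (vector [b1, b2, b3] \<notin> A \<longrightarrow> (\<forall>x>0. \<Phi> x > 0))"
proof -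
  have a: "a1 > 0" "a2 > 0" using assms(1) by (auto simp: Lambda_region_def)
  obtain h where h: "h \<in> convex hull A" and hb: "\<And>i. h $ i \<le> (vector [b1, b2, b3] :: real ^ 3) $ i"
    using assms(3) by (rule newton_polyhedron_imp_hull) blast
  \<comment> \<open>\<open>V\<close> belongs to the parameters (a2, a1+1/2, 2 a1), where a2 cancels;
    \<open>W\<close> replaces them by the hull point \<open>h\<close>, and \<open>F\<close> raises
    \<open>h\<close> to \<open>b\<close>.\<close>
  define V where "V = (\<lambda>n. (-1) ^ n * (pochhammer a1 n / (fact n * (pochhammer (a1 + 1/2) n * pochhammer (2 * a1) n))))"
  define W where "W = (\<lambda>n. V n * ((pochhammer a2 n * pochhammer (a1 + 1/2) n * pochhammer (2 * a1) n)
                          / (pochhammer (h $ 1) n * pochhammer (h $ 2) n * pochhammer (h $ 3) n)))"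
  define F where "F = (\<lambda>n. W n * ((pochhammer (h $ 1) n * pochhammer (h $ 2) n * pochhammer (h $ 3) n)
                          / (pochhammer b1 n * pochhammer b2 n * pochhammer b3 n)))"
  have V: "pos_series V" unfolding V_def by (rule pos_series_1F2_square[OF a(1)])
  have v: "a2 > 0" "a1 + 1/2 > 0" "2 * a1 > 0" using a by auto
  note hull = hull_coord_permutations_multiplier[OF V v h[unfolded assms(2)], folded W_def assms(2)]
  have hull_strict: "(\<Sum>n. W n * s ^ n) > 0" if "h \<notin> A" "s \<ge> 0" for s
    using hull(3)[OF that] by (simp only: W_def)
  have le: "h $ 1 \<le> b1" "h $ 2 \<le> b2" "h $ 3 \<le> b3" using hb[of 1] hb[of 2] hb[of 3] by simp_all
  note raise = raise_parameters_multiplier[OF hull(2) hull(1) hull(1) hull(1) le, folded F_def]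
  have raise_strict: "(\<Sum>n. F n * s ^ n) > 0"
    if "(b1, b2, b3) \<noteq> (h $ 1, h $ 2, h $ 3)" "s \<ge> 0" for s
    using raise(2)[OF that] by (simp only: F_def)
  have F: "F n = (-1) ^ n * (pochhammer a1 n * pochhammer a2 n
      / (fact n * (pochhammer b1 n * pochhammer b2 n * pochhammer b3 n)))" for n
    using pochhammer_pos[OF v(2), of n] pochhammer_pos[OF v(3), of n]
      pochhammer_pos[OF hull(1)[of 1], of n] pochhammer_pos[OF hull(1)[of 2], of n]
      pochhammer_pos[OF hull(1)[of 3], of n]
    by (simp add: F_def W_def V_def)
  have Phi: "\<Phi> x = (\<Sum>n. F n * (x\<^sup>2) ^ n)" for x
    unfolding assms(4) hypergeo_2F3_series F by (simp add: power_minus[of "x\<^sup>2"] mult_ac)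
  have "\<Phi> x \<ge> 0" for x using raise(1) by (simp add: Phi pos_series_def)
  moreover have "\<Phi> x > 0" if b: "vector [b1, b2, b3] \<notin> A" for x
  \<comment> \<open>If b = h, then h is not a vertex and the passage from \<open>V\<close> to
    \<open>W\<close> is already strict. Otherwise some coordinate is truly raised and the passage
    from \<open>W\<close> to \<open>F\<close> is strict.\<close>
  proof (cases "(b1, b2, b3) = (h $ 1, h $ 2, h $ 3)")
    case True
    then have "vector [b1, b2, b3] = h" by (simp add: vec_eq_iff forall_3)
    moreover have "F = W" using True
      pochhammer_pos[OF hull(1)[of 1]] pochhammer_pos[OF hull(1)[of 2]] pochhammer_pos[OF hull(1)[of 3]]
      by (simp add: F_def fun_eq_iff less_imp_neq[symmetric])
    ultimately show ?thesis using hull_strict b by (simp add: Phi)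
  next
    case False
    then show ?thesis using raise_strict by (simp add: Phi)
  qed
  ultimately show ?thesis by blast
qed

end
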